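(* Let $d \geq 2$ be an even integer and let $n \geq d$ be an integer. Then $$\left(\sum_{r=0}^{d/2}\binom{n}{r}\right) - \binom{n-1}{d/2} \;\leq\; \operatorname{rank}(\sigma_{d,n}) \;\leq\; \sum_{r=0}^{d/2} \binom{n}{r}.$$
   Context: $\sigma_{d,n} = \sum_{I \subset \{1,\dots,n\}, |I| = d} \prod_{i \in I} x_i \in \mathbb{C}[x_1,\dots,x_n]$ is the elementary symmetric polynomial of degree $d$ in $n$ variables. For a form (homogeneous polynomial) $F \in \mathbb{C}[x_1,\dots,x_n]$ of degree $d$, its (symmetric tensor) rank $\operatorname{rank}(F)$ is the least integer $s$ such that $F = \sum_{i=1}^s L_i^d$ for some linear forms $L_1,\dots,L_s \in \mathbb{C}[x_1,\dots,x_n]$. *)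

theory Defs
  imports Complex_Main "HOL-Library.Poly_Mapping"
begin

text \<open>
  Polynomials over the complex numbers in the variables \<open>x\<^sub>0, x\<^sub>1, \<dots>\<close> as finitely supported maps from
  exponent vectors to coefficients, with the convolution product. The ring in \<open>x\<^sub>1, \<dots>, x\<^sub>n\<close>
  consists of those polynomials whose monomials involve only indices in \<open>{1..n}\<close>; all sums and
  products below range over such indices explicitly.
\<close>

type_synonym cpoly = "(nat \<Rightarrow>\<^sub>0 nat) \<Rightarrow>\<^sub>0 complex"

definition Var :: "nat \<Rightarrow> cpoly"
  where "Var i = Poly_Mapping.single (Poly_Mapping.single i 1) 1"

definition Const :: "complex \<Rightarrow> cpoly"
  where "Const c = Poly_Mapping.single 0 c"

definition elem_sym :: "nat \<Rightarrow> nat \<Rightarrow> cpoly"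
  where "elem_sym d n = (\<Sum>I | I \<subseteq> {1..n} \<and> card I = d. \<Prod>i\<in>I. Var i)"

definition linear_form :: "nat \<Rightarrow> cpoly \<Rightarrow> bool"
  where "linear_form n L \<longleftrightarrow> (\<exists>a :: nat \<Rightarrow> complex. L = (\<Sum>i = 1..n. Const (a i) * Var i))"

text \<open>
  The degree \<open>d\<close> of the form and the number \<open>n\<close> of variables are explicit arguments. The value is
  meaningful only if some decomposition exists, as it does for every form of degree \<open>d\<close> in
  \<open>x\<^sub>1, \<dots>, x\<^sub>n\<close> with \<open>d \<ge> 1\<close>; otherwise \<open>LEAST\<close> is unspecified.
\<close>

definition form_rank :: "nat \<Rightarrow> nat \<Rightarrow> cpoly \<Rightarrow> nat"
  where "form_rank n d F =
    (LEAST s. \<exists>L :: nat \<Rightarrow> cpoly. (\<forall>i\<in>{1..s}. linear_form n (L i)) \<and> F = (\<Sum>i = 1..s. L i ^ d))"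

end

theory Submission
  imports Defs
begin

text \<open>
  Write \<open>d = 2 * k\<close>. Comparing coefficients (\<open>elem_sym_eq_sum_powers_iff\<close>), a decomposition of
  \<open>elem_sym d n\<close> into powers of linear forms with coefficient vectors \<open>a p\<close> is the same as a condition on
  the power sums \<open>\<Sum>p. \<Prod>i. a p i ^ e i\<close> for exponents \<open>e\<close> of degree \<open>d\<close>: they vanish unless \<open>e\<close> is
  square-free, and then have the value \<open>1 / fact d\<close>.

  For the upper bound, take one vector of signs for each set \<open>I\<close> with at most \<open>k\<close> elements, with
  minus signs on \<open>I\<close>. The weighted power sum at \<open>e\<close> is then a combination of characters
  \<open>\<Prod>i\<in>I. \<eta> i\<close> at the sign vector \<open>\<eta> i = (- 1) ^ e i\<close>. Exponents of degree \<open>d\<close> have an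
  even number of odd entries, and the square-free ones are those with \<open>d\<close> odd entries. A polynomial of degree
  \<open>k\<close> in the number of odd entries separates them from the \<open>k\<close> remaining values
  \<open>0, 2, \<dots>, d - 2\<close>, and it is a combination of characters of sets with at most \<open>k\<close> elements
  (\<open>prod_shifted_sums_in_span_characters\<close>). The weights are absorbed by \<open>d\<close>-th roots.

  For the lower bound, set \<open>x\<^sub>1 = 1\<close> on the linear forms that involve \<open>x\<^sub>1\<close>. A decomposition
  becomes a weighted sum of evaluations at points of affine \<open>(n - 1)\<close>-space; this functional kills all
  monomials of degree at most \<open>d - 1\<close> except the square-free ones of degree \<open>d - 1\<close>. It defines a
  nondegenerate bilinear form on the functions on these points. Square-free monomials of degree less than
  \<open>k\<close> span an isotropic subspace for it, and they are linearly independent on the points by the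
  full rank of inclusion matrices (\<open>zero_if_subset_sums_zero\<close>). An isotropic subspace has at most
  half the dimension of the space (\<open>two_card_le_if_isotropic\<close>), so there are at least
  \<open>2 * (\<Sum>r<k. (n - 1) choose r)\<close> points, which is the claimed number by Pascal's rule.
\<close>

section \<open>Isotropic subspaces\<close>

lemma nontrivial_solution_if_underdetermined:
  fixes v :: "'b \<Rightarrow> 'p \<Rightarrow> complex"
  assumes "finite P" "finite B" "card P < card B"
  shows "\<exists>x. (\<exists>b\<in>B. x b \<noteq> 0) \<and> (\<forall>p\<in>P. (\<Sum>b\<in>B. x b * v b p) = 0)"
  using assms
proof (induction P arbitrary: B v rule: finite_induct)
  case empty
  then have "B \<noteq> {}" by auto
  then show ?case by (intro exI[of _ "\<lambda>_. 1"]) auto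
next
  case (insert q P)
  show ?case
  proof (cases "\<forall>b\<in>B. v b q = 0")
    case True
    have "card P < card B" using insert.prems insert.hyps by simp
    then obtain x where "\<exists>b\<in>B. x b \<noteq> 0" "\<forall>p\<in>P. (\<Sum>b\<in>B. x b * v b p) = 0"
      using insert.IH[of B v] insert.prems(1) by blast
    moreover have "(\<Sum>b\<in>B. x b * v b q) = 0" using True by (intro sum.neutral) simp
    ultimately show ?thesis by blast
  next
    case False
    then obtain b where b: "b \<in> B" "v b q \<noteq> 0" by blast
    define w where "w a p = v a p - v a q / v b q * v b p" for a p
    have "card P < card (B - {b})" using insert.prems insert.hyps b by simp
    then obtain x where x: "\<exists>a\<in>B - {b}. x a \<noteq> 0"
      "\<And>p. p \<in> P \<Longrightarrow> (\<Sum>a\<in>B - {b}. x a * w a p) = 0"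
      using insert.IH[of "B - {b}" w] insert.prems(1) by blast
    define s where "s = - (\<Sum>a\<in>B - {b}. x a * v a q) / v b q"
    define x' where "x' = x(b := s)"
    have split: "(\<Sum>a\<in>B. x' a * v a p) = s * v b p + (\<Sum>a\<in>B - {b}. x a * v a p)" for p
    proof -
      have "(\<Sum>a\<in>B - {b}. x' a * v a p) = (\<Sum>a\<in>B - {b}. x a * v a p)"
        by (intro sum.cong) (auto simp: x'_def)
      then show ?thesis
        using insert.prems(1) b by (simp add: sum.remove[of B b] x'_def)
    qed
    have "(\<Sum>a\<in>B. x' a * v a p) = 0" if "p \<in> insert q P" for p
    proof (cases "p = q")
      case True
      then show ?thesis using b by (simp add: split s_def)
    next
      case False
      then have "(\<Sum>a\<in>B - {b}. x a * w a p) = 0" using that x(2) by simp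
      also have "(\<Sum>a\<in>B - {b}. x a * w a p) = (\<Sum>a\<in>B. x' a * v a p)"
        unfolding split s_def w_def
        by (simp add: algebra_simps sum_subtractf sum_distrib_left sum_distrib_right sum_divide_distrib)
      finally show ?thesis .
    qed
    moreover have "\<exists>a\<in>B. x' a \<noteq> 0" using x(1) by (auto simp: x'_def)
    ultimately show ?thesis by blast
  qed
qed

text \<open>
  An isotropic subspace \<open>U\<close> of a space with a nondegenerate symmetric form has at most half the dimension.
  For the diagonal form with entries \<open>c p\<close>, complex conjugation gives a direct proof: isotropy says
  that \<open>U\<close> and the space of all \<open>cnj (c p * w p)\<close> with \<open>w\<close> in \<open>U\<close>, which has the same dimension, are
  orthogonal for the Hermitian product, so they are independent in a space of dimension \<open>card P\<close>.
\<close>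

lemma two_card_le_if_isotropic:
  fixes u :: "'b \<Rightarrow> 'p \<Rightarrow> complex" and c :: "'p \<Rightarrow> complex"
  assumes P: "finite P" and B: "finite B"
    and c: "\<And>p. p \<in> P \<Longrightarrow> c p \<noteq> 0"
    and indep: "\<And>x b. \<lbrakk>\<forall>p\<in>P. (\<Sum>b\<in>B. x b * u b p) = 0; b \<in> B\<rbrakk> \<Longrightarrow> x b = 0"
    and iso: "\<And>b b'. \<lbrakk>b \<in> B; b' \<in> B\<rbrakk> \<Longrightarrow> (\<Sum>p\<in>P. c p * u b p * u b' p) = 0"
  shows "2 * card B \<le> card P"
proof (rule ccontr)
  assume "\<not> 2 * card B \<le> card P"
  then have lt: "card P < card (B <+> B)" using B by (simp add: card_Plus)
  define v where "v = case_sum u (\<lambda>b p. cnj (c p * u b p))"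
  obtain x where x: "\<exists>b\<in>B <+> B. x b \<noteq> 0"
    "\<And>p. p \<in> P \<Longrightarrow> (\<Sum>b\<in>B <+> B. x b * v b p) = 0"
    using nontrivial_solution_if_underdetermined[OF P _ lt, of v] B by (meson finite_Plus)
  define z where "z p = (\<Sum>b\<in>B. x (Inl b) * u b p)" for p
  define w where "w p = (\<Sum>b\<in>B. cnj (x (Inr b)) * u b p)" for p
  \<comment> \<open>A vector in both spaces: the relation says so, and orthogonality to itself makes it
     vanish.\<close>
  have rel: "z p = - cnj (c p * w p)" if "p \<in> P" for p
  proof -
    have "0 = z p + (\<Sum>b\<in>B. x (Inr b) * cnj (c p * u b p))"
      using x(2)[OF that] B by (simp add: sum.Plus z_def v_def)
    also have "(\<Sum>b\<in>B. x (Inr b) * cnj (c p * u b p)) = cnj (c p * w p)"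
      by (simp add: w_def sum_distrib_left mult.left_commute)
    finally show ?thesis by (simp add: eq_neg_iff_add_eq_0)
  qed
  have "(\<Sum>p\<in>P. z p * (c p * w p)) = 
      (\<Sum>p\<in>P. \<Sum>b\<in>B. \<Sum>b'\<in>B. x (Inl b) * cnj (x (Inr b')) * (c p * u b p * u b' p))"
  proof (intro sum.cong refl)
    fix p
    have "z p * (c p * w p) = c p * (z p * w p)" by simp
    also have "\<dots> = (\<Sum>b\<in>B. \<Sum>b'\<in>B. x (Inl b) * cnj (x (Inr b')) * (c p * u b p * u b' p))"
      unfolding z_def w_def sum_product by (simp add: sum_distrib_left mult_ac)
    finally show "z p * (c p * w p) =
      (\<Sum>b\<in>B. \<Sum>b'\<in>B. x (Inl b) * cnj (x (Inr b')) * (c p * u b p * u b' p))" .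
  qed
  also have "\<dots> = (\<Sum>b\<in>B. \<Sum>b'\<in>B. x (Inl b) * cnj (x (Inr b')) * (\<Sum>p\<in>P. c p * u b p * u b' p))"
    by (subst sum.swap, intro sum.cong refl, subst sum.swap) (simp add: sum_distrib_left)
  also have "\<dots> = 0" by (simp add: iso)
  finally have "(\<Sum>p\<in>P. z p * (c p * w p)) = 0" .
  moreover have "(\<Sum>p\<in>P. z p * (c p * w p)) = - of_real (\<Sum>p\<in>P. (cmod (c p * w p))\<^sup>2)"
  proof -
    have "z p * (c p * w p) = - of_real ((cmod (c p * w p))\<^sup>2)" if "p \<in> P" for p
      unfolding rel[OF that] complex_norm_square by (metis mult.commute mult_minus_left)
    then show ?thesis by (simp add: sum_negf)
  qed
  ultimately have "(\<Sum>p\<in>P. (cmod (c p * w p))\<^sup>2) = 0"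
    by (metis neg_equal_0_iff_equal of_real_eq_0_iff)
  then have cw: "c p * w p = 0" if "p \<in> P" for p
    using that P by (simp add: sum_nonneg_eq_0_iff)
  then have "\<forall>p\<in>P. w p = 0" "\<forall>p\<in>P. z p = 0" using c rel by fastforce+
  then have "cnj (x (Inr b)) = 0" "x (Inl b) = 0" if "b \<in> B" for b
    using indep[of "\<lambda>b. cnj (x (Inr b))" b] indep[of "\<lambda>b. x (Inl b)" b] that
    unfolding w_def z_def by blast+
  then show False using x(1) by auto
qed

section \<open>Functions on subsets of fixed size\<close>

lemma sum_subsets_insert:
  fixes a :: "'v set \<Rightarrow> complex"
  assumes "finite K" "p \<notin> K"
  shows "(\<Sum>J | J \<subseteq> insert p K \<and> card J = Suc j. a J)
    = (\<Sum>J | J \<subseteq> K \<and> card J = Suc j. a J) + (\<Sum>J | J \<subseteq> K \<and> card J = j. a (insert p J))"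
proof -
  have fin: "finite {J. J \<subseteq> K \<and> card J = i}" for i
    using assms(1) by simp
  have eq: "{J. J \<subseteq> insert p K \<and> card J = Suc j}
      = {J. J \<subseteq> K \<and> card J = Suc j} \<union> insert p ` {J. J \<subseteq> K \<and> card J = j}" (is "?L = ?R")
  proof (intro set_eqI iffI)
    fix J assume J: "J \<in> ?L"
    show "J \<in> ?R"
    proof (cases "p \<in> J")
      case True
      then have "J = insert p (J - {p})" by auto
      moreover have "card (J - {p}) = j" using J True by simp
      ultimately show ?thesis using J by blast
    qed (use J in auto)
  next
    fix J assume J: "J \<in> ?R"
    have "card (insert p J') = Suc (card J')" if "J' \<subseteq> K" for J'
      using that assms by (metis card_insert_disjoint finite_subset subsetD)
    then show "J \<in> ?L" using J by auto
  qed
  have "inj_on (insert p) {J. J \<subseteq> K \<and> card J = j}"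
    using assms(2) by (intro inj_onI) (metis insert_ident mem_Collect_eq subsetD)
  moreover have "{J. J \<subseteq> K \<and> card J = Suc j} \<inter> insert p ` {J. J \<subseteq> K \<and> card J = j} = {}"
    using assms(2) by auto
  ultimately show ?thesis
    unfolding eq using fin by (simp add: sum.union_disjoint sum.reindex)
qed

text \<open>
  This is the full rank of the inclusion matrix of \<open>j\<close>-subsets against \<open>k\<close>-subsets. Subtracting the
  equations of \<open>insert p K\<close> and \<open>insert q K\<close>, where \<open>K\<close> has \<open>k - 1\<close> elements, leaves the equation
  of \<open>K\<close> for the function
  \<open>I \<mapsto> a (insert p I) - a (insert q I)\<close> on \<open>(j - 1)\<close>-sets that avoid \<open>p\<close> and \<open>q\<close>. By induction this
  function is zero, so \<open>a\<close> does not change when one element of a \<open>j\<close>-set is exchanged. Hence \<open>a\<close> is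
  constant, and one equation shows that the constant is zero. Removing two points at a time is what
  preserves the hypothesis \<open>k + j \<le> card V\<close>.
\<close>

lemma zero_if_subset_sums_zero:
  fixes a :: "'v set \<Rightarrow> complex"
  assumes "finite V" "j \<le> k" "k + j \<le> card V"
    and "\<And>K. \<lbrakk>K \<subseteq> V; card K = k\<rbrakk> \<Longrightarrow> (\<Sum>J | J \<subseteq> K \<and> card J = j. a J) = 0"
    and "J \<subseteq> V" "card J = j"
  shows "a J = 0"
  using assms
proof (induction j arbitrary: V k a J)
  case 0
  then obtain K where K: "K \<subseteq> V" "card K = k"
    by (metis add.right_neutral obtain_subset_with_card_n)
  then have "finite K" using 0 by (simp add: finite_subset)
  then have "{J. J \<subseteq> K \<and> card J = 0} = {{}}" by (auto simp: card_eq_0_iff finite_subset)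
  moreover have "J = {}" using 0 by (simp add: finite_subset card_eq_0_iff)
  ultimately show ?case using "0.prems"(4)[OF K] by simp
next
  case (Suc j)
  note fV = Suc.prems(1)
  obtain k' where k': "k = Suc k'" using Suc.prems(2) by (cases k) auto
  have exchange: "a (insert p I) = a (insert q I)"
    if pq: "p \<in> V" "q \<in> V" "p \<noteq> q" and I: "I \<subseteq> V - {p, q}" "card I = j" for p q I
  proof -
    have card: "card (V - {p, q}) = card V - 2" using pq fV by (simp add: card_Diff_subset)
    have "a (insert p I) - a (insert q I) = 0"
    proof (rule Suc.IH[of "V - {p, q}" k' "\<lambda>I. a (insert p I) - a (insert q I)" I])
      show "finite (V - {p, q})" using fV by simp
      show "j \<le> k'" "k' + j \<le> card (V - {p, q})" using Suc.prems(2,3) k' card by auto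
      fix K assume K: "K \<subseteq> V - {p, q}" "card K = k'"
      have fK: "finite K" using K fV by (meson finite_Diff finite_subset)
      have "p \<notin> K" "q \<notin> K" using K by auto
      then have sums: "(\<Sum>J | J \<subseteq> insert r K \<and> card J = Suc j. a J) = 0" if "r \<in> {p, q}" for r
        using that K pq fK k' by (intro Suc.prems(4)) auto
      have "(\<Sum>J | J \<subseteq> K \<and> card J = Suc j. a J) + (\<Sum>I | I \<subseteq> K \<and> card I = j. a (insert r I)) = 0"
        if "r \<in> {p, q}" for r
        using sums[OF that] sum_subsets_insert[OF fK, of r a j] that \<open>p \<notin> K\<close> \<open>q \<notin> K\<close> by auto
      then have "(\<Sum>I | I \<subseteq> K \<and> card I = j. a (insert r I)) = - (\<Sum>J | J \<subseteq> K \<and> card J = Suc j. a J)"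
        if "r \<in> {p, q}" for r
        using that by (simp only: add_eq_0_iff)
      then show "(\<Sum>I | I \<subseteq> K \<and> card I = j. a (insert p I) - a (insert q I)) = 0"
        by (simp add: sum_subtractf)
    qed (use I in auto)
    then show ?thesis by simp
  qed
  have const: "a I = a J" if "I \<subseteq> V" "card I = Suc j" "card (I - J) = m" for I m
    using that
  proof (induction m arbitrary: I)
    case 0
    have f: "finite I" "finite J" using 0 Suc.prems fV by (auto simp: finite_subset)
    with 0 have "I \<subseteq> J" by simp
    then have "I = J" using f 0 Suc.prems by (metis card_subset_eq)
    then show ?case by simp
  next
    case (Suc m)
    note IJ = Suc.prems \<open>J \<subseteq> V\<close> \<open>card J = _\<close>
    have f: "finite I" "finite J" using IJ fV by (auto simp: finite_subset)
    have "I - J \<noteq> {}" using IJ by (metis card.empty nat.distinct(1))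
    then obtain p where p: "p \<in> I - J" by blast
    have "\<not> J \<subseteq> I" using IJ f p by (metis DiffD1 DiffD2 card_subset_eq)
    then obtain q where q: "q \<in> J - I" by blast
    define I' where "I' = I - {p}"
    have I': "I = insert p I'" "card I' = j" "I' \<subseteq> V - {p, q}" "finite I'"
      using p q IJ f by (auto simp: I'_def)
    have "insert q I' - J = (I - J) - {p}" using p q by (auto simp: I'_def)
    then have "card (insert q I' - J) = m" using p IJ f by simp
    moreover have "insert q I' \<subseteq> V" "card (insert q I') = Suc j"
      using I' q IJ by (auto simp: card_insert_if)
    ultimately have "a (insert q I') = a J" by (rule Suc.IH[rotated 2])
    moreover have "a (insert p I') = a (insert q I')"
      using p q IJ I' by (intro exchange) auto
    ultimately show ?case using I' by simp
  qed
  have "card V \<ge> k" using Suc.prems by simp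
  then obtain K where K: "J \<subseteq> K" "K \<subseteq> V" "card K = k"
    using Suc.prems(2,5,6) by (metis fV exists_subset_between)
  have fK: "finite K" using K fV finite_subset by blast
  have "0 = (\<Sum>I | I \<subseteq> K \<and> card I = Suc j. a I)" using Suc.prems(4) K by simp
  also have "\<dots> = (\<Sum>I | I \<subseteq> K \<and> card I = Suc j. a J)"
    by (intro sum.cong refl const) (use K in auto)
  also have "\<dots> = of_nat (card K choose Suc j) * a J"
    using fK by (simp add: n_subsets)
  finally show ?case using Suc.prems(2) K by (simp add: binomial_eq_0_iff)
qed

section \<open>Coefficients of powers of linear forms\<close>

abbreviation lookup :: "('a \<Rightarrow>\<^sub>0 'b::zero) \<Rightarrow> 'a \<Rightarrow> 'b"
  where "lookup \<equiv> Poly_Mapping.lookup"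

abbreviation keys :: "('a \<Rightarrow>\<^sub>0 'b::zero) \<Rightarrow> 'a set"
  where "keys \<equiv> Poly_Mapping.keys"

lemma lookup_single_times_add:
  fixes e :: "'a::cancel_comm_monoid_add" and p :: "'a \<Rightarrow>\<^sub>0 'b::semiring_0"
  shows "lookup (Poly_Mapping.single k c * p) (k + e) = c * lookup p e"
proof -
  have "lookup (Poly_Mapping.single k c * p) (k + e)
      = (\<Sum>l. lookup (Poly_Mapping.single k c) l * (\<Sum>q. lookup p q when k + e = l + q))"
    by (simp add: lookup_mult)
  also have "\<dots> = (\<Sum>l. c * (\<Sum>q. lookup p q when k + e = l + q) when l = k)"
    by (rule Sum_any.cong) (simp add: lookup_single when_def)
  also have "\<dots> = c * lookup p e"
    by simp
  finally show ?thesis .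
qed

lemma lookup_single_times_eq_0:
  fixes e :: "'a::cancel_comm_monoid_add" and p :: "'a \<Rightarrow>\<^sub>0 'b::semiring_0"
  assumes "\<And>e'. e \<noteq> k + e'"
  shows "lookup (Poly_Mapping.single k c * p) e = 0"
proof -
  have "e \<notin> keys (Poly_Mapping.single k c * p)"
    using assms keys_mult[of "Poly_Mapping.single k c" p] by (fastforce split: if_splits)
  then show ?thesis by (simp add: in_keys_iff)
qed

lemma lookup_Const_Var_times:
  "lookup (Const c * Var i * p) e
    = (if lookup e i = 0 then 0 else c * lookup p (e - Poly_Mapping.single i 1))"
proof -
  have mono: "Const c * Var i = Poly_Mapping.single (Poly_Mapping.single i 1) c"
    by (simp add: Const_def Var_def mult_single)
  show ?thesis
  proof (cases "lookup e i = 0")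
    case True
    have "e \<noteq> Poly_Mapping.single i 1 + e'" for e'
      using True by (auto simp: lookup_add)
    then show ?thesis using True by (simp add: mono lookup_single_times_eq_0)
  next
    case False
    have "e = Poly_Mapping.single i 1 + (e - Poly_Mapping.single i 1)"
      using False by (intro poly_mapping_eqI) (auto simp: lookup_add lookup_minus lookup_single when_def)
    then show ?thesis using False
      by (metis mono lookup_single_times_add)
  qed
qed

lemma prod_lookup_add_single:
  fixes f :: "'i \<Rightarrow> nat \<Rightarrow> 'a::comm_semiring_1"
  assumes "finite A" "i \<in> A"
  shows "(\<Prod>l\<in>A. f l (lookup (Poly_Mapping.single i 1 + e) l))
    = f i (Suc (lookup e i)) * (\<Prod>l\<in>A - {i}. f l (lookup e l))"
proof -
  have "(\<Prod>l\<in>A - {i}. f l (lookup (Poly_Mapping.single i 1 + e) l)) = (\<Prod>l\<in>A - {i}. f l (lookup e l))"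
    by (intro prod.cong) (auto simp: lookup_add lookup_single)
  then show ?thesis using assms by (simp add: prod.remove[of A i] lookup_add)
qed

text \<open>
  The multinomial theorem. The product of factorials stands on the left because in this form
  it follows by induction on \<open>d\<close> from Euler's identity: the factor \<open>a i x\<^sub>i\<close> contributes
  \<open>lookup e i\<close> times the right-hand side, and these exponents add up to the degree.
\<close>

lemma coeff_power_linear_form:
  assumes A: "finite A"
  shows "lookup ((\<Sum>i\<in>A. Const (a i) * Var i) ^ d) e * (\<Prod>i\<in>A. fact (lookup e i))
    = (if keys e \<subseteq> A \<and> (\<Sum>i\<in>A. lookup e i) = d
       then fact d * (\<Prod>i\<in>A. a i ^ lookup e i) else 0)"
proof (induction d arbitrary: e)
  case 0
  show ?case
  proof (cases "e = 0")
    case False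
    then have "\<not> (keys e \<subseteq> A \<and> (\<Sum>i\<in>A. lookup e i) = 0)"
      using A by (metis in_keys_iff subsetD poly_mapping_eqI lookup_zero sum_eq_0_iff)
    then show ?thesis using False by (auto simp: lookup_one)
  qed (simp add: lookup_one)
next
  case (Suc d)
  let ?L = "\<Sum>i\<in>A. Const (a i) * Var i"
  let ?s = "\<lambda>i. Poly_Mapping.single i (1::nat)"
  define R where "R = (if keys e \<subseteq> A \<and> (\<Sum>i\<in>A. lookup e i) = Suc d
       then fact d * (\<Prod>i\<in>A. a i ^ lookup e i) else 0)"
  have summand: "lookup (Const (a i) * Var i * ?L ^ d) e * (\<Prod>i\<in>A. fact (lookup e i))
      = of_nat (lookup e i) * R" if i: "i \<in> A" for i
  proof (cases "lookup e i = 0")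
    case False
    define e' where "e' = e - ?s i"
    have e: "e = ?s i + e'"
      using False by (intro poly_mapping_eqI) (auto simp: e'_def lookup_add lookup_minus lookup_single when_def)
    have e_i: "lookup e i = Suc (lookup e' i)"
      by (simp add: e lookup_add)
    have "(\<Prod>l\<in>A. fact (lookup e l))
        = fact (Suc (lookup e' i)) * (\<Prod>l\<in>A - {i}. fact (lookup e' l) :: complex)"
      using prod_lookup_add_single[OF A i, of "\<lambda>_. fact" e'] by (simp only: e)
    then have fac: "(\<Prod>l\<in>A. fact (lookup e l)) = of_nat (lookup e i) * (\<Prod>l\<in>A. fact (lookup e' l) :: complex)"
      by (simp only: e_i fact_Suc prod.remove[OF A i, of "\<lambda>l. fact (lookup e' l)"] mult.assoc)
    have "(\<Prod>l\<in>A. a l ^ lookup e l)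
        = a i ^ Suc (lookup e' i) * (\<Prod>l\<in>A - {i}. a l ^ lookup e' l)"
      using prod_lookup_add_single[OF A i, of "\<lambda>l m. a l ^ m" e'] by (simp only: e)
    then have pow: "(\<Prod>l\<in>A. a l ^ lookup e l) = a i * (\<Prod>l\<in>A. a l ^ lookup e' l)"
      by (simp only: power_Suc prod.remove[OF A i, of "\<lambda>l. a l ^ lookup e' l"] mult.assoc)
    have keys: "keys e \<subseteq> A \<longleftrightarrow> keys e' \<subseteq> A"
      unfolding e using i by (auto simp: in_keys_iff lookup_add lookup_single when_def subset_iff)
    have deg: "(\<Sum>l\<in>A. lookup e l) = Suc (\<Sum>l\<in>A. lookup e' l)"
      unfolding e using A i by (simp add: lookup_add sum.distrib lookup_single when_def)
    have "lookup (Const (a i) * Var i * ?L ^ d) e = a i * lookup (?L ^ d) e'"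
      using False by (simp add: lookup_Const_Var_times e'_def)
    then have "lookup (Const (a i) * Var i * ?L ^ d) e * (\<Prod>i\<in>A. fact (lookup e i))
        = of_nat (lookup e i) * a i * (lookup (?L ^ d) e' * (\<Prod>l\<in>A. fact (lookup e' l)))"
      by (simp add: fac)
    also have "\<dots> = of_nat (lookup e i) * R"
      by (simp add: Suc.IH R_def keys deg pow)
    finally show ?thesis .
  qed (simp add: lookup_Const_Var_times)
  have "lookup (?L ^ Suc d) e * (\<Prod>i\<in>A. fact (lookup e i))
      = (\<Sum>i\<in>A. lookup (Const (a i) * Var i * ?L ^ d) e * (\<Prod>i\<in>A. fact (lookup e i)))"
    by (simp add: sum_distrib_right lookup_sum)
  also have "\<dots> = of_nat (\<Sum>i\<in>A. lookup e i) * R"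
    by (simp add: summand sum_distrib_right)
  finally show ?case by (simp add: R_def algebra_simps del: of_nat_sum power_Suc)
qed

lemma coeff_elem_sym:
  "lookup (elem_sym d n) e
    = (if keys e \<subseteq> {1..n} \<and> (\<Sum>i = 1..n. lookup e i) = d \<and> (\<forall>i. lookup e i \<le> 1) then 1 else 0)"
proof -
  define m where "m I = (\<Sum>i\<in>I. Poly_Mapping.single i (1::nat))" for I :: "nat set"
  have mono: "(\<Prod>i\<in>I. Var i) = Poly_Mapping.single (m I) 1" for I
    by (induction I rule: infinite_finite_induct) (auto simp: m_def Var_def mult_single single_one[symmetric] simp del: single_one)
  have look: "lookup (m I) i = (if i \<in> I then 1 else 0)" if "finite I" for I i
    using that by (simp add: m_def lookup_sum lookup_single when_def)
  have m_eq: "m I = e \<longleftrightarrow> I = keys e \<and> (\<forall>i. lookup e i \<le> 1)" if "finite I" for I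
  proof
    assume "m I = e"
    then have "lookup e i = (if i \<in> I then 1 else 0)" for i using look[OF that] by metis
    then show "I = keys e \<and> (\<forall>i. lookup e i \<le> 1)" by (auto simp: in_keys_iff split: if_splits)
  next
    assume "I = keys e \<and> (\<forall>i. lookup e i \<le> 1)"
    then have "lookup e i = (if i \<in> I then 1 else 0)" for i
      by (metis in_keys_iff le_antisym less_one linorder_not_less)
    then show "m I = e" using that by (intro poly_mapping_eqI) (simp add: look)
  qed
  let ?S = "{I. I \<subseteq> {1..n} \<and> card I = d}"
  have "lookup (elem_sym d n) e = (\<Sum>I\<in>?S. if m I = e then 1 else 0)"
    by (simp add: elem_sym_def mono lookup_sum lookup_single when_def)
  also have "\<dots> = (\<Sum>I\<in>?S. if I = keys e then (if \<forall>i. lookup e i \<le> 1 then 1 else 0) else 0)"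
  proof (intro sum.cong refl)
    fix I assume "I \<in> ?S"
    then have "finite I" by (auto intro: finite_subset)
    from m_eq[OF this] show "(if m I = e then 1 else 0)
        = (if I = keys e then (if \<forall>i. lookup e i \<le> 1 then 1 else 0) else 0 :: complex)"
      by simp
  qed
  also have "\<dots> = (if keys e \<in> ?S \<and> (\<forall>i. lookup e i \<le> 1) then 1 else 0)"
    by simp
  also have "keys e \<in> ?S \<and> (\<forall>i. lookup e i \<le> 1) \<longleftrightarrow>
    keys e \<subseteq> {1..n} \<and> (\<Sum>i = 1..n. lookup e i) = d \<and> (\<forall>i. lookup e i \<le> 1)"
  proof -
    have "(\<Sum>i = 1..n. lookup e i) = card (keys e)"
      if "keys e \<subseteq> {1..n}" "\<forall>i. lookup e i \<le> 1"
    proof -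
      have "(\<Sum>i = 1..n. lookup e i) = (\<Sum>i\<in>keys e. lookup e i)"
        using that by (intro sum.mono_neutral_right) (auto simp: in_keys_iff)
      also have "\<dots> = (\<Sum>i\<in>keys e. 1)"
        using that by (intro sum.cong refl) (metis in_keys_iff le_antisym less_one linorder_not_less)
      finally show ?thesis by simp
    qed
    then show ?thesis by auto
  qed
  finally show ?thesis .
qed

text \<open>
  Multinomial coefficients never vanish in characteristic zero, so comparing coefficients turns a
  decomposition into a condition on the power sums of the coefficient vectors \<open>a p\<close>: they vanish on
  every exponent of degree \<open>d\<close> except the square-free ones, where they all have the same value, as
  \<open>fact d\<close> is the multinomial coefficient of every square-free exponent. Both bounds on the rank
  work with this condition only.
\<close>

lemma elem_sym_eq_sum_powers_iff:
  assumes P: "finite P"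
  shows "elem_sym d n = (\<Sum>p\<in>P. (\<Sum>i = 1..n. Const (a p i) * Var i) ^ d) \<longleftrightarrow>
    (\<forall>e :: nat \<Rightarrow> nat. (\<Sum>i = 1..n. e i) = d \<longrightarrow>
      fact d * (\<Sum>p\<in>P. \<Prod>i = 1..n. a p i ^ e i) = (if \<forall>i\<in>{1..n}. e i \<le> 1 then 1 else 0))"
    (is "?F = ?G \<longleftrightarrow> ?R")
proof -
  let ?c = "\<lambda>e. \<Prod>i = 1..n. fact (lookup e i) :: complex"
  have c0: "?c e \<noteq> 0" for e by simp
  have G: "lookup ?G e * ?c e = (if keys e \<subseteq> {1..n} \<and> (\<Sum>i = 1..n. lookup e i) = d
       then fact d * (\<Sum>p\<in>P. \<Prod>i = 1..n. a p i ^ lookup e i) else 0)" for e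
    unfolding lookup_sum sum_distrib_right coeff_power_linear_form[OF finite_atLeastAtMost]
    by (cases "keys e \<subseteq> {1..n} \<and> (\<Sum>i = 1..n. lookup e i) = d")
      (simp_all only: if_True if_False sum_distrib_left sum.neutral_const simp_thms)
  have F: "lookup ?F e * ?c e = (if keys e \<subseteq> {1..n} \<and> (\<Sum>i = 1..n. lookup e i) = d
       then (if \<forall>i\<in>{1..n}. lookup e i \<le> 1 then 1 else 0) else 0)" for e
  proof (cases "keys e \<subseteq> {1..n}")
    case True
    have "(\<forall>i. lookup e i \<le> 1) \<longleftrightarrow> (\<forall>i\<in>{1..n}. lookup e i \<le> 1)"
      using True by (metis in_keys_iff subsetD zero_le)
    moreover have "?c e = 1" if "\<forall>i\<in>{1..n}. lookup e i \<le> 1"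
      using that by (intro prod.neutral) (auto simp: le_Suc_eq)
    ultimately show ?thesis using True by (auto simp: coeff_elem_sym)
  qed (simp add: coeff_elem_sym)
  have "?F = ?G \<longleftrightarrow> (\<forall>e. lookup ?F e * ?c e = lookup ?G e * ?c e)"
    using c0 by (simp add: poly_mapping_eq_iff fun_eq_iff)
  also have "\<dots> \<longleftrightarrow> (\<forall>e. keys e \<subseteq> {1..n} \<longrightarrow> (\<Sum>i = 1..n. lookup e i) = d \<longrightarrow>
      fact d * (\<Sum>p\<in>P. \<Prod>i = 1..n. a p i ^ lookup e i)
        = (if \<forall>i\<in>{1..n}. lookup e i \<le> 1 then 1 else 0))"
    unfolding F G by (intro all_cong1) (auto simp del: of_nat_fact)
  also have "\<dots> \<longleftrightarrow> ?R"
  proof (intro iffI allI impI)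
    fix f :: "nat \<Rightarrow> nat"
    assume *: "\<forall>e. keys e \<subseteq> {1..n} \<longrightarrow> (\<Sum>i = 1..n. lookup e i) = d \<longrightarrow>
      fact d * (\<Sum>p\<in>P. \<Prod>i = 1..n. a p i ^ lookup e i)
        = (if \<forall>i\<in>{1..n}. lookup e i \<le> 1 then 1 else 0)"
      and f: "(\<Sum>i = 1..n. f i) = d"
    define e where "e = (\<Sum>i = 1..n. Poly_Mapping.single i (f i))"
    have e: "lookup e i = (if i \<in> {1..n} then f i else 0)" for i
      by (simp add: e_def lookup_sum lookup_single when_def)
    then have "keys e \<subseteq> {1..n}" by (metis in_keys_iff subsetI)
    moreover have "(\<Sum>i = 1..n. lookup e i) = (\<Sum>i = 1..n. f i)"
      "(\<Prod>i = 1..n. a p i ^ lookup e i) = (\<Prod>i = 1..n. a p i ^ f i)"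
      "(\<forall>i\<in>{1..n}. lookup e i \<le> 1) \<longleftrightarrow> (\<forall>i\<in>{1..n}. f i \<le> 1)" for p
      using e by (auto intro!: sum.cong prod.cong)
    ultimately show "fact d * (\<Sum>p\<in>P. \<Prod>i = 1..n. a p i ^ f i)
        = (if \<forall>i\<in>{1..n}. f i \<le> 1 then 1 else 0)"
      using *[rule_format, of e] f by (simp only:)
  qed blast
  finally show ?thesis .
qed

section \<open>A decomposition into signed power sums\<close>

text \<open>
  On sign vectors, multiplying the monomial of \<open>I\<close> by \<open>\<eta> i\<close> gives the monomial of the symmetric
  difference of \<open>I\<close> and \<open>{i}\<close>, since \<open>\<eta> i\<close> squares to one. So each factor raises the size of the
  index sets by at most one.
\<close>

lemma prod_shifted_sums_in_span_characters:
  fixes l :: "nat \<Rightarrow> complex"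
  assumes A: "finite A"
  shows "\<exists>c. \<forall>\<eta>. (\<forall>i\<in>A. \<eta> i * \<eta> i = 1) \<longrightarrow>
    (\<Prod>t<k. (\<Sum>i\<in>A. \<eta> i) - l t) = (\<Sum>I | I \<subseteq> A \<and> card I \<le> k. c I * (\<Prod>i\<in>I. \<eta> i))"
proof (induction k)
  case 0
  have "{I. I \<subseteq> A \<and> card I \<le> 0} = {{}}" using A by (auto simp: finite_subset)
  then show ?case by (intro exI[of _ "\<lambda>_. 1"]) simp
next
  case (Suc k)
  define S where "S k = {I. I \<subseteq> A \<and> card I \<le> k}" for k
  have fin: "finite (S k)" for k using A by (simp add: S_def)
  obtain c where c: "\<And>\<eta>. \<forall>i\<in>A. \<eta> i * \<eta> i = 1 \<Longrightarrow>
    (\<Prod>t<k. (\<Sum>i\<in>A. \<eta> i) - l t) = (\<Sum>I\<in>S k. c I * (\<Prod>i\<in>I. \<eta> i))"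
    using Suc.IH unfolding S_def by blast
  define toggle where "toggle i I = (if i \<in> I then I - {i} else insert i I)" for i and I :: "'a set"
  have invol: "toggle i (toggle i I) = I" for i I by (auto simp: toggle_def)
  have step: "toggle i I \<in> S (Suc k)" if "i \<in> A" "I \<in> S k" for i I
  proof -
    have "finite I" using that A by (auto simp: S_def finite_subset)
    then show ?thesis using that by (auto simp: S_def toggle_def card_insert_if)
  qed
  define c' where "c' I = (\<Sum>i\<in>A. if toggle i I \<in> S k then c (toggle i I) else 0)
    - (if I \<in> S k then l k * c I else 0)" for I
  have "(\<Prod>t<Suc k. (\<Sum>i\<in>A. \<eta> i) - l t) = (\<Sum>I\<in>S (Suc k). c' I * (\<Prod>i\<in>I. \<eta> i))"
    if \<eta>: "\<forall>i\<in>A. \<eta> i * \<eta> i = 1" for \<eta>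
  proof -
    define X where "X I = (\<Prod>i\<in>I. \<eta> i)" for I
    have mult: "X I * \<eta> i = X (toggle i I)" if "i \<in> A" "I \<in> S k" for i I
    proof -
      have "finite I" using that A by (auto simp: S_def finite_subset)
      then show ?thesis using \<eta> that
        by (auto simp: X_def toggle_def prod.remove mult_ac)
    qed
    have "(\<Sum>I\<in>S k. c I * X I) * \<eta> i
        = (\<Sum>I\<in>S (Suc k). (if toggle i I \<in> S k then c (toggle i I) else 0) * X I)" if i: "i \<in> A" for i
    proof -
      have "(\<Sum>I\<in>S k. c I * X I) * \<eta> i = (\<Sum>I\<in>S k. c I * X (toggle i I))"
        using i by (simp add: sum_distrib_right mult.assoc mult cong: sum.cong)
      also have "\<dots> = (\<Sum>I\<in>{I \<in> S (Suc k). toggle i I \<in> S k}. c (toggle i I) * X I)"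
        by (rule sum.reindex_bij_witness[of _ "toggle i" "toggle i"]) (auto simp: invol step i)
      also have "\<dots> = (\<Sum>I\<in>S (Suc k). if toggle i I \<in> S k then c (toggle i I) * X I else 0)"
        using fin by (simp add: sum.inter_filter)
      finally show ?thesis by (simp add: if_distrib[of "\<lambda>x. x * _"] cong: if_cong)
    qed
    then have "(\<Sum>I\<in>S k. c I * X I) * (\<Sum>i\<in>A. \<eta> i)
        = (\<Sum>I\<in>S (Suc k). (\<Sum>i\<in>A. if toggle i I \<in> S k then c (toggle i I) else 0) * X I)"
      by (simp add: sum_distrib_left sum_distrib_right sum.swap[of _ A] cong: sum.cong)
    moreover have "(\<Sum>I\<in>S k. c I * X I) * l k = (\<Sum>I\<in>S (Suc k). (if I \<in> S k then l k * c I else 0) * X I)"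
    proof -
      have "S k \<subseteq> S (Suc k)" by (auto simp: S_def)
      then have "(\<Sum>I\<in>S (Suc k). (if I \<in> S k then l k * c I else 0) * X I) = (\<Sum>I\<in>S k. l k * c I * X I)"
        using fin by (intro sum.mono_neutral_cong_right) auto
      then show ?thesis by (simp add: sum_distrib_left sum_distrib_right mult_ac)
    qed
    ultimately show ?thesis
      using c[OF \<eta>] by (simp add: c'_def X_def right_diff_distrib left_diff_distrib sum_subtractf)
  qed
  then show ?case unfolding S_def by blast
qed

lemma ex_complex_root:
  assumes "d > 0"
  shows "\<exists>w. w ^ d = (z :: complex)"
proof
  show "rcis (root d (cmod z)) (Arg z / real d) ^ d = z"
    using assms by (simp add: DeMoivre2 rcis_cmod_Arg)
qed

text \<open>
  The linear forms are multiples of \<open>\<Sum>i. \<plusminus> x\<^sub>i\<close> with the minus signs on \<open>I\<close>. At an exponent \<open>e\<close>, the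
  power sums with weights \<open>c I\<close> equal \<open>\<Sum>I. c I * (\<Prod>i\<in>I. \<eta> i)\<close> with \<open>\<eta> i = (- 1) ^ e i\<close>, so they
  depend only on the parities of \<open>e\<close>. If \<open>j\<close> entries of \<open>e\<close> are odd, then \<open>\<Sum>i. \<eta> i = n - 2 * j\<close>.
  As the degree \<open>d = 2 * k\<close> is even, so is \<open>j\<close>, and \<open>j = d\<close> exactly for the square-free exponents.
  Hence the product of the \<open>k\<close> factors \<open>(\<Sum>i. \<eta> i) - (n - 4 * t)\<close> with \<open>t < k\<close> vanishes at all
  exponents of degree \<open>d\<close> but the square-free ones, where it is a nonzero constant. The weights come
  from writing this product as a combination of characters.
\<close>

lemma elem_sym_eq_sum_signed_powers:
  assumes k: "k \<ge> 1" and d: "d = 2 * k"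
  shows "\<exists>a. elem_sym d n =
    (\<Sum>I | I \<subseteq> {1..n} \<and> card I \<le> k. (\<Sum>i = 1..n. Const (a I i) * Var i) ^ d)"
proof -
  let ?S = "{I. I \<subseteq> {1..n} \<and> card I \<le> k}"
  obtain c :: "nat set \<Rightarrow> complex" where c: "\<And>\<eta>. \<forall>i\<in>{1..n}. \<eta> i * \<eta> i = 1 \<Longrightarrow>
    (\<Prod>t<k. (\<Sum>i = 1..n. \<eta> i) - (of_nat n - 4 * of_nat t)) = (\<Sum>I\<in>?S. c I * (\<Prod>i\<in>I. \<eta> i))"
    using prod_shifted_sums_in_span_characters[OF finite_atLeastAtMost, of 1 n "\<lambda>t. of_nat n - 4 * of_nat t" k]
    by blast
  \<comment> \<open>The value of the product at square-free exponents: the sum of signs is \<open>n - 4 *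
     k\<close>.\<close>
  define C where "C = (\<Prod>t<k. 4 * of_nat t - 4 * of_nat k :: complex)"
  have "C \<noteq> 0" by (auto simp: C_def)
  have "\<exists>w. w ^ d = c I / (fact d * C)" for I using k d by (intro ex_complex_root) auto
  then obtain w where w: "\<And>I. w I ^ d = c I / (fact d * C)" by metis
  define a where "a I i = w I * (if i \<in> I then - 1 else 1)" for I and i :: nat
  have "fact d * (\<Sum>I\<in>?S. \<Prod>i = 1..n. a I i ^ e i) = (if \<forall>i\<in>{1..n}. e i \<le> 1 then 1 else 0)"
    if e: "(\<Sum>i = 1..n. e i) = d" for e
  proof -
    define \<eta> where "\<eta> i = (- 1 :: complex) ^ e i" for i
    define T where "T = {i \<in> {1..n}. odd (e i)}"
    have summand: "(\<Prod>i = 1..n. a I i ^ e i) = w I ^ d * (\<Prod>i\<in>I. \<eta> i)" if "I \<in> ?S" for I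
    proof -
      have "(\<Prod>i = 1..n. a I i ^ e i) = w I ^ d * (\<Prod>i = 1..n. (if i \<in> I then - 1 else 1) ^ e i)"
        by (simp only: a_def power_mult_distrib prod.distrib power_sum[symmetric] e)
      also have "(\<Prod>i = 1..n. (if i \<in> I then - 1 else 1) ^ e i) = (\<Prod>i\<in>I. \<eta> i)"
        using that by (intro prod.mono_neutral_cong_right) (auto simp: \<eta>_def)
      finally show ?thesis .
    qed
    have "fact d * (\<Sum>I\<in>?S. \<Prod>i = 1..n. a I i ^ e i) = (\<Sum>I\<in>?S. c I * (\<Prod>i\<in>I. \<eta> i)) / C"
      unfolding sum_distrib_left sum_divide_distrib
      by (intro sum.cong refl) (simp only: summand w, simp)
    also have "\<dots> = (\<Prod>t<k. (\<Sum>i = 1..n. \<eta> i) - (of_nat n - 4 * of_nat t)) / C"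
      by (subst c) (auto simp: \<eta>_def power_mult_distrib[symmetric])
    also have "(\<Sum>i = 1..n. \<eta> i) = of_nat n - 2 * of_nat (card T)"
    proof -
      have "(\<Sum>i = 1..n. \<eta> i) = (\<Sum>i = 1..n. 1 - 2 * (if odd (e i) then 1 else 0))"
        by (intro sum.cong) (auto simp: \<eta>_def)
      also have "\<dots> = of_nat n - 2 * (\<Sum>i = 1..n. if odd (e i) then 1 else 0)"
        by (simp add: sum_subtractf sum_distrib_left)
      also have "(\<Sum>i = 1..n. if odd (e i) then 1 else 0 :: complex) = of_nat (card T)"
        by (simp add: T_def sum.inter_filter[symmetric])
      finally show ?thesis .
    qed
    also have "(\<Prod>t<k. of_nat n - 2 * of_nat (card T) - (of_nat n - 4 * of_nat t)) / C
        = (if \<forall>i\<in>{1..n}. e i \<le> 1 then 1 else 0)"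
    proof (cases "\<forall>i\<in>{1..n}. e i \<le> 1")
      case True
      then have "e i = (if odd (e i) then 1 else 0)" if "i \<in> {1..n}" for i
        using that by (metis even_zero le_Suc_eq le_zero_eq One_nat_def odd_one)
      then have "d = (\<Sum>i = 1..n. if odd (e i) then 1 else 0)"
        unfolding e[symmetric] by (intro sum.cong) auto
      also have "\<dots> = card T"
        by (simp add: T_def sum.inter_filter[symmetric])
      finally have "card T = 2 * k" using d by simp
      then have "(\<Prod>t<k. of_nat n - 2 * of_nat (card T) - (of_nat n - 4 * of_nat t)) = C"
        by (simp add: C_def)
      then show ?thesis by (simp only: if_P[OF True] divide_self[OF \<open>C \<noteq> 0\<close>])
    next
      case False
      have "card T < d"
      proof -
        have "card T = (\<Sum>i = 1..n. if odd (e i) then 1 else 0)"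
          by (simp add: T_def sum.inter_filter[symmetric])
        also have "\<dots> < (\<Sum>i = 1..n. e i)"
        proof (rule sum_strict_mono_ex1)
          obtain i where i: "i \<in> {1..n}" "e i > 1" using False by (auto simp: not_le)
          then show "\<exists>i\<in>{1..n}. (if odd (e i) then 1 else 0) < e i"
            by (intro bexI[of _ i]) auto
        qed (auto simp: Suc_le_eq odd_pos)
        finally show ?thesis using e by simp
      qed
      moreover have "even (card T)"
        using e d even_sum_iff[of "{1..n}" e] by (simp add: T_def)
      ultimately obtain t where "card T = 2 * t" "t < k" using d by (auto elim: evenE)
      then have "(\<Prod>t<k. of_nat n - 2 * of_nat (card T) - (of_nat n - 4 * of_nat t)) = (0::complex)"
        by (intro prod_zero) auto
      then show ?thesis by (simp only: if_not_P[OF False] div_0)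
    qed
    finally show ?thesis .
  qed
  then show ?thesis by (intro exI[of _ a] elem_sym_eq_sum_powers_iff[THEN iffD2] allI impI) simp_all
qed

section \<open>The lower bound for the number of powers\<close>

text \<open>
  Powers whose linear form does not involve \<open>x\<^sub>1\<close> disappear from the derivative
  \<open>\<partial>\<sigma>/\<partial>x\<^sub>1\<close>, so only the points \<open>a p\<close> with \<open>a p 1 \<noteq> 0\<close> are used. In the chart
  \<open>x\<^sub>1 = 1\<close> they carry the functional \<open>\<phi>(f) = (\<Sum>p\<in>Q. c p * f p)\<close>, which by the condition on
  power sums is zero on all monomials in \<open>x\<^sub>2, \<dots>, x\<^sub>n\<close> of degree less than \<open>d - 1\<close>, and on those of
  degree \<open>d - 1\<close> that are not square-free, but not on the square-free ones.
  The form \<open>(f, g) \<mapsto> \<phi>(f * g)\<close> is diagonal and nondegenerate on functions on the points. The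
  monomials \<open>u J\<close> with \<open>card J < k\<close> span an isotropic subspace, since products of two of them have
  degree at most \<open>2 * (k - 1) < d - 1\<close>. They are independent as functions: in a relation, pair the
  monomials of the largest degree \<open>j\<close> with those of degree \<open>d - 1 - j\<close>; what is left is a vanishing
  sum over the \<open>j\<close>-subsets of each set of a fixed size, which forces the coefficients to be zero.
\<close>

lemma two_card_small_subsets_le_num_powers:
  assumes P: "finite P" and k: "k \<ge> 1" and d: "d = 2 * k" and n: "n \<ge> d"
    and decomp: "elem_sym d n = (\<Sum>p\<in>P. (\<Sum>i = 1..n. Const (a p i) * Var i) ^ d)"
  shows "2 * card {J. J \<subseteq> {2..n} \<and> card J < k} \<le> card P"
proof -
  define V where "V = {2..n}"
  define B where "B = {J. J \<subseteq> V \<and> card J < k}"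
  define Q where "Q = {p \<in> P. a p 1 \<noteq> 0}"
  define c where "c p = a p 1 ^ d" for p
  define u where "u J p = (\<Prod>i\<in>J. a p i / a p 1)" for J p
  have V: "finite V" "card V = n - 1" "{1..n} = insert 1 V" "1 \<notin> V"
    using k d n by (auto simp: V_def)
  have fin: "finite J" if "J \<subseteq> V" for J using that V(1) finite_subset by blast
  have finB: "finite B" using V by (simp add: B_def)
  have pairing: "(\<Sum>p\<in>Q. c p * u I p * u J p)
      = (if I \<inter> J = {} \<and> card I + card J = d - 1 then 1 / fact d else 0)"
    if IJ: "I \<subseteq> V" "J \<subseteq> V" "card I + card J < d" for I J
  proof -
    define m where "m = d - card I - card J"
    \<comment> \<open>The monomial of degree \<open>d\<close> that restricts to the product of the monomials
       of \<open>I\<close> and \<open>J\<close> in the chart.\<close>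
    define e where "e i = (if i = 1 then m else of_bool (i \<in> I) + of_bool (i \<in> J))" for i
    have eV: "e i = of_bool (i \<in> I) + of_bool (i \<in> J)" if "i \<in> V" for i
      using that V by (auto simp: e_def)
    have "(\<Sum>i\<in>V. e i) = card I + card J"
      using IJ V(1) by (simp add: eV sum.distrib of_bool_def sum.If_cases Int_absorb1 cong: sum.cong)
    then have sum_e: "(\<Sum>i = 1..n. e i) = d"
      using V IJ by (simp add: e_def m_def)
    have monom: "(\<Prod>i = 1..n. a p i ^ e i) = a p 1 ^ m * ((\<Prod>i\<in>I. a p i) * (\<Prod>i\<in>J. a p i))" for p
    proof -
      have "(\<Prod>i\<in>V. a p i ^ of_bool (i \<in> J)) = (\<Prod>i\<in>J. a p i)" if "J \<subseteq> V" for J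
        using that V(1) by (intro prod.mono_neutral_cong_right) auto
      then have "(\<Prod>i\<in>V. a p i ^ e i) = (\<Prod>i\<in>I. a p i) * (\<Prod>i\<in>J. a p i)"
        using IJ by (simp add: eV power_add prod.distrib cong: prod.cong)
      then show ?thesis using V by (simp add: e_def)
    qed
    have "c p * u I p * u J p = (\<Prod>i = 1..n. a p i ^ e i)" if "p \<in> Q" for p
    proof -
      have "a p 1 \<noteq> 0" using that by (simp add: Q_def)
      moreover have "d = m + card I + card J" using IJ by (simp add: m_def)
      ultimately show ?thesis
        unfolding monom c_def u_def by (simp add: prod_dividef power_add field_simps)
    qed
    then have "(\<Sum>p\<in>Q. c p * u I p * u J p) = (\<Sum>p\<in>Q. \<Prod>i = 1..n. a p i ^ e i)" by simp
    also have "\<dots> = (\<Sum>p\<in>P. \<Prod>i = 1..n. a p i ^ e i)"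
    proof (intro sum.mono_neutral_left ballI)
      show "(\<Prod>i = 1..n. a p i ^ e i) = 0" if "p \<in> P - Q" for p
        unfolding monom using that IJ by (auto simp: Q_def m_def)
    qed (use P in \<open>auto simp: Q_def\<close>)
    also have "fact d * \<dots> = (if \<forall>i\<in>{1..n}. e i \<le> 1 then 1 else 0)"
      using decomp sum_e unfolding elem_sym_eq_sum_powers_iff[OF P] by blast
    then have "(\<Sum>p\<in>P. \<Prod>i = 1..n. a p i ^ e i) = (if \<forall>i\<in>{1..n}. e i \<le> 1 then 1 / fact d else 0)"
      by (auto simp: field_simps split: if_splits)
    also have "(\<forall>i\<in>{1..n}. e i \<le> 1) \<longleftrightarrow> m \<le> 1 \<and> (\<forall>i\<in>V. of_bool (i \<in> I) + of_bool (i \<in> J) \<le> (1::nat))"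
      using V(3) eV by (auto simp: e_def)
    also have "(\<forall>i\<in>V. of_bool (i \<in> I) + of_bool (i \<in> J) \<le> (1::nat)) \<longleftrightarrow> I \<inter> J = {}"
      using IJ by (auto simp: of_bool_def split: if_splits)
    also have "m \<le> 1 \<longleftrightarrow> card I + card J = d - 1" using IJ by (auto simp: m_def)
    finally show ?thesis by (simp add: conj_commute)
  qed
  have "2 * card B \<le> card Q"
  proof (rule two_card_le_if_isotropic[where c = c and u = u])
    show "finite Q" "finite B" using P finB by (auto simp: Q_def)
    show "c p \<noteq> 0" if "p \<in> Q" for p using that by (simp add: Q_def c_def)
    show "(\<Sum>p\<in>Q. c p * u I p * u J p) = 0" if "I \<in> B" "J \<in> B" for I J
      using that d by (subst pairing) (auto simp: B_def)
  next
    fix x J assume x: "\<forall>p\<in>Q. (\<Sum>J\<in>B. x J * u J p) = 0" and "J \<in> B"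
    \<comment> \<open>Downward induction on the degree: all coefficients of larger degree are already zero.\<close>
    from \<open>J \<in> B\<close> show "x J = 0"
    proof (induction "k - card J" arbitrary: J rule: less_induct)
      case less
      define j where "j = card J"
      have j: "j < k" "J \<subseteq> V" using less.prems by (auto simp: j_def B_def)
      show ?case
      proof (rule zero_if_subset_sums_zero[of V j "n - d + j" x])
        show "finite V" "j \<le> n - d + j" "J \<subseteq> V" "card J = j" using V j by (auto simp: j_def)
        show "n - d + j + j \<le> card V" using j V d n by simp
        fix K assume K: "K \<subseteq> V" "card K = n - d + j"
        \<comment> \<open>Sets disjoint from \<open>V - K\<close> are the subsets of \<open>K\<close>.\<close>
        have cardI: "card (V - K) = d - 1 - j"
          using K V j d n fin by (simp add: card_Diff_subset)
        have "0 = (\<Sum>p\<in>Q. c p * u (V - K) p * (\<Sum>J\<in>B. x J * u J p))" using x by simp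
        also have "\<dots> = (\<Sum>J\<in>B. x J * (\<Sum>p\<in>Q. c p * u (V - K) p * u J p))"
          unfolding sum_distrib_left by (subst sum.swap) (simp add: mult_ac)
        also have "\<dots> = (\<Sum>J\<in>B. if J \<subseteq> K \<and> card J = j then x J / fact d else 0)"
        proof (intro sum.cong refl)
          fix L assume L: "L \<in> B"
          show "x L * (\<Sum>p\<in>Q. c p * u (V - K) p * u L p) = (if L \<subseteq> K \<and> card L = j then x L / fact d else 0)"
          proof (cases "card L \<le> j")
            case True
            have "(V - K) \<inter> L = {} \<longleftrightarrow> L \<subseteq> K" using L by (auto simp: B_def)
            moreover have "card (V - K) + card L = d - 1 \<longleftrightarrow> card L = j"
              using cardI True j d by auto
            moreover have "card (V - K) + card L < d" using cardI True j d by auto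
            ultimately show ?thesis using L by (subst pairing) (auto simp: B_def)
          next
            case False
            then have "x L = 0" using L by (intro less.hyps) (auto simp: j_def B_def)
            then show ?thesis by simp
          qed
        qed
        also have "\<dots> = (\<Sum>J | J \<in> B \<and> J \<subseteq> K \<and> card J = j. x J / fact d)"
          using finB by (simp add: sum.inter_filter)
        also have "{J. J \<in> B \<and> J \<subseteq> K \<and> card J = j} = {J. J \<subseteq> K \<and> card J = j}"
          using K j by (auto simp: B_def)
        finally show "(\<Sum>J | J \<subseteq> K \<and> card J = j. x J) = 0"
          by (simp add: sum_divide_distrib[symmetric])
      qed
    qed
  qed
  also have "card Q \<le> card P" using P by (auto simp: Q_def intro: card_mono)
  finally show ?thesis by (simp add: B_def V_def)
qed

section \<open>Bounds on the rank\<close>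

lemma card_subsets_less:
  assumes "finite A"
  shows "card {J. J \<subseteq> A \<and> card J < k} = (\<Sum>r<k. card A choose r)"
proof (induction k)
  case (Suc k)
  have "{J. J \<subseteq> A \<and> card J < Suc k} = {J. J \<subseteq> A \<and> card J < k} \<union> {J. J \<subseteq> A \<and> card J = k}"
    by (auto simp: less_Suc_eq)
  moreover have "card ({J. J \<subseteq> A \<and> card J < k} \<union> {J. J \<subseteq> A \<and> card J = k})
      = card {J. J \<subseteq> A \<and> card J < k} + card {J. J \<subseteq> A \<and> card J = k}"
    using assms by (intro card_Un_disjoint) auto
  ultimately show ?case using Suc.IH assms by (simp add: n_subsets)
qed simp

lemma sum_binomial_Suc:
  "(\<Sum>r = 0..k. Suc N choose r) = (N choose k) + 2 * (\<Sum>r<k. N choose r)"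
  by (induction k) (simp_all add: atLeast0_atMost_Suc)

lemma linear_form_family:
  assumes "\<forall>i\<in>I. linear_form n (L i)"
  obtains a where "\<And>i. i \<in> I \<Longrightarrow> L i = (\<Sum>l = 1..n. Const (a i l) * Var l)"
  using assms unfolding linear_form_def by metis

theorem corollary4p4:
  fixes d n :: nat
  assumes "d \<ge> 2" and "even d" and "n \<ge> d"
  shows "(\<Sum>r = 0..d div 2. int (n choose r)) - int ((n - 1) choose (d div 2))
           \<le> int (form_rank n d (elem_sym d n))
       \<and> form_rank n d (elem_sym d n) \<le> (\<Sum>r = 0..d div 2. n choose r)"
proof -
  define k where "k = d div 2"
  have k: "k \<ge> 1" "d = 2 * k" using assms by (auto simp: k_def)
  define decomposable where "decomposable s \<longleftrightarrow> (\<exists>L :: nat \<Rightarrow> cpoly.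
    (\<forall>i\<in>{1..s}. linear_form n (L i)) \<and> elem_sym d n = (\<Sum>i = 1..s. L i ^ d))" for s
  have rank: "form_rank n d (elem_sym d n) = (LEAST s. decomposable s)"
    by (simp add: form_rank_def decomposable_def)
  define S where "S = {I. I \<subseteq> {1..n} \<and> card I \<le> k}"
  have "card S = (\<Sum>r<Suc k. n choose r)"
    using card_subsets_less[of "{1..n}" "Suc k"] by (simp add: S_def less_Suc_eq_le)
  then have card_S: "card S = (\<Sum>r = 0..k. n choose r)"
    by (simp add: atLeast0AtMost lessThan_Suc_atMost)
  have upper: "decomposable (card S)"
  proof -
    obtain a where a: "elem_sym d n = (\<Sum>I\<in>S. (\<Sum>i = 1..n. Const (a I i) * Var i) ^ d)"
      using elem_sym_eq_sum_signed_powers[OF k] unfolding S_def by blast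
    have "finite S" by (simp add: S_def)
    then obtain h where h: "bij_betw h {1..card S} S" using ex_bij_betw_nat_finite_1 by blast
    let ?L = "\<lambda>s. \<Sum>i = 1..n. Const (a (h s) i) * Var i"
    have "elem_sym d n = (\<Sum>s = 1..card S. ?L s ^ d)"
      unfolding a by (rule sum.reindex_bij_betw[OF h, symmetric])
    moreover have "linear_form n (?L s)" for s unfolding linear_form_def by blast
    ultimately show ?thesis unfolding decomposable_def by (intro exI[of _ ?L]) blast
  qed
  have lower: "2 * (\<Sum>r<k. (n - 1) choose r) \<le> s" if s: "decomposable s" for s
  proof -
    obtain L where L: "\<forall>i\<in>{1..s}. linear_form n (L i)" "elem_sym d n = (\<Sum>i = 1..s. L i ^ d)"
      using s unfolding decomposable_def by blast
    obtain a where "\<And>i. i \<in> {1..s} \<Longrightarrow> L i = (\<Sum>l = 1..n. Const (a i l) * Var l)"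
      using linear_form_family[OF L(1)] by blast
    then have "elem_sym d n = (\<Sum>i = 1..s. (\<Sum>l = 1..n. Const (a i l) * Var l) ^ d)"
      using L(2) by simp
    from two_card_small_subsets_le_num_powers[OF _ k \<open>n \<ge> d\<close> this] show ?thesis
      using card_subsets_less[of "{2..n}" k] by (simp add: numeral_2_eq_2)
  qed
  have "form_rank n d (elem_sym d n) \<le> (\<Sum>r = 0..k. n choose r)"
    unfolding rank card_S[symmetric] by (rule Least_le[of decomposable, OF upper])
  moreover have "2 * (\<Sum>r<k. (n - 1) choose r) \<le> form_rank n d (elem_sym d n)"
    unfolding rank by (rule lower[OF LeastI[of decomposable, OF upper]])
  moreover have "(\<Sum>r = 0..k. n choose r) = ((n - 1) choose k) + 2 * (\<Sum>r<k. (n - 1) choose r)"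
    using sum_binomial_Suc[of "n - 1" k] assms by simp
  ultimately show ?thesis
    unfolding k_def[symmetric] of_nat_sum[symmetric] by linarith
qed

end
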